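(* Let $\overline{x}\in\mathrm{dom}(\partial F)$ and suppose that $g^*$ satisfies the calmness condition on $\mathrm{dom}(g^* )$. Let $\theta\in[0,1)$. If $Q$ satisfies the KL property with exponent $\theta$ at $(\overline{x},\overline{y})$ for every $\overline{y}\in\partial g(\overline{x})$, then $F$ satisfies the KL property with the same exponent $\theta$ at $\overline{x}$.
   Context: Setting. $f,g,h:\mathbb{R}^n\to(-\infty,+\infty]$ are proper lower semicontinuous functions, $\Omega:=\{x\in\mathbb{R}^n: g(x)\neq 0\}$ is nonempty, and $f$ is block-separable: $f(x)=\sum_{i=1}^N f_i(x_i)$, where the subvectors $x_i\in\mathbb{R}^{n_i}$ form a partition of the components of $x$ and each $f_i:\mathbb{R}^{n_i}\to(-\infty,+\infty]$ is proper lower semicontinuous. Standing assumptions: (a) $f$ is continuous on $\mathrm{dom}(f)$ and each $f_i$ is bounded below; (b) $h$ is locally Lipschitz differentiable on $\Omega$, i.e. every $x\in\Omega$ has a neighborhood $\mathcal{B}(x)$ and a constant $L_x$ with $\|\nabla h(u)-\nabla h(v)\|_2\le L_x\|u-v\|_2$ for all $u,v\in\mathcal{B}(x)\cap\Omega$; (c) $g$ is convex, real-valued and nonnegative on $\mathbb{R}^n$; (d) $f+h\ge 0$ on $\mathrm{dom}(f)$. Notation. $\mathrm{dom}(\varphi)=\{x:\varphi(x)<+\infty\}$; $g^*(y)=\sup_x\{\langle x,y\rangle-g(x)\}$; $\zeta(x):=f(x)+h(x)$; $\eta(x,y):=\langle x,y\rangle-g^*(y)$. $F(x)=\zeta(x)/g(x)$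 if $x\in\Omega\cap\mathrm{dom}(f)$ and $F(x)=+\infty$ otherwise. $Q(x,y)=\zeta(x)/\eta(x,y)$ if $(x,y)\in\mathrm{dom}(f)\times\mathrm{dom}(g^* )$ and $\eta(x,y)>0$, and $Q(x,y)=+\infty$ otherwise. Subdifferentials. For a proper function $\varphi$ and $x\in\mathrm{dom}(\varphi)$, the Fréchet subdifferential is $\widehat{\partial}\varphi(x)=\{y:\liminf_{z\to x,z\ne x}\frac{\varphi(z)-\varphi(x)-\langle y,z-x\rangle}{\|z-x\|_2}\ge 0\}$ and the limiting subdifferential is $\partial\varphi(x)=\{y:\exists x^k\to x,\ \varphi(x^k)\to\varphi(x),\ y^k\in\widehat{\partial}\varphi(x^k),\ y^k\to y\}$ (both coincide with the usual subdifferential for convex $\varphi$). $\mathrm{dom}(\partial\varphi)=\{x\in\mathrm{dom}(\varphi):\partial\varphi(x)\ne\emptyset\}$. $\mathrm{dist}(0,\emptyset)=+\infty$. Calmness. $\varphi$ satisfies the calmness condition on a set $\mathcal{A}\subseteq\mathrm{dom}(\varphi)$ if for every $x\in\mathcal{A}$ there are $\kappa_x>0$ and a neighborhood $\mathcal{B}(x)$ with $|\varphi(u)-\varphi(x)|\le\kappa_x\|u-x\|_2$ for all $u\in\mathcal{B}(x)\cap\mathcal{A}$. KL property. A proper function $\varphi$ satisfies the KL property at $x\in\mathrm{dom}(\partial\varphi)$ if there exist $\epsilon\in(0,+\infty]$, $\delta>0$ and a continuous concave $\phi:[0,\epsilon)\to[0,+\infty)$ with $\phi(0)=0$, $\phi$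 continuously differentiable on $(0,\epsilon)$ with $\phi'>0$, such that $\phi'(\varphi(z)-\varphi(x))\,\mathrm{dist}(0,\partial\varphi(z))\ge1$ for all $z$ with $\|z-x\|_2<\delta$ and $\varphi(x)<\varphi(z)<\varphi(x)+\epsilon$. If $\phi$ can be chosen as $\phi(s)=a_0s^{1-\theta}$ with $a_0>0$, $\theta\in[0,1)$, then $\varphi$ satisfies the KL property at $x$ with exponent $\theta$. *)

theory Defs
  imports "HOL-Analysis.Analysis"
begin

text \<open>Functions into \<open>(-\<infinity>, +\<infinity>]\<close> are \<^typ>\<open>ereal\<close>-valued functions that are proper.
  The variants with a set argument are for the block functions, which live on a subspace.\<close>

definition proper_fun_on :: "'a set \<Rightarrow> ('a \<Rightarrow> ereal) \<Rightarrow> bool" where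
  "proper_fun_on S \<phi> \<longleftrightarrow> (\<forall>x\<in>S. \<phi> x \<noteq> -\<infinity>) \<and> (\<exists>x\<in>S. \<phi> x < \<infinity>)"

abbreviation proper_fun :: "('a \<Rightarrow> ereal) \<Rightarrow> bool" where
  "proper_fun \<equiv> proper_fun_on UNIV"

definition lsc_on :: "'a::topological_space set \<Rightarrow> ('a \<Rightarrow> ereal) \<Rightarrow> bool" where
  "lsc_on S \<phi> \<longleftrightarrow> (\<forall>x\<in>S. \<phi> x \<le> Liminf (at x within S) \<phi>)"

abbreviation lsc :: "('a::topological_space \<Rightarrow> ereal) \<Rightarrow> bool" where
  "lsc \<equiv> lsc_on UNIV"

definition effdom :: "('a \<Rightarrow> ereal) \<Rightarrow> 'a set" where
  "effdom \<phi> = {x. \<phi> x < \<infinity>}"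

definition fenchel_conj :: "('a::real_inner \<Rightarrow> ereal) \<Rightarrow> 'a \<Rightarrow> ereal" where
  "fenchel_conj g y = (SUP x. ereal (x \<bullet> y) - g x)"


text \<open>Both subdifferentials are empty outside the effective domain.\<close>

definition frechet_subdiff :: "('a::euclidean_space \<Rightarrow> ereal) \<Rightarrow> 'a \<Rightarrow> 'a set" where
  "frechet_subdiff \<phi> x = {y. x \<in> effdom \<phi> \<and>
     0 \<le> Liminf (at x) (\<lambda>z. (\<phi> z - \<phi> x - ereal (y \<bullet> (z - x))) / ereal (norm (z - x)))}"

definition limiting_subdiff :: "('a::euclidean_space \<Rightarrow> ereal) \<Rightarrow> 'a \<Rightarrow> 'a set" where
  "limiting_subdiff \<phi> x = {y. x \<in> effdom \<phi> \<and>
     (\<exists>xs ys. xs \<longlonglongrightarrow> x \<and> (\<lambda>k. \<phi> (xs k)) \<longlonglongrightarrow> \<phi> x \<and>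
        (\<forall>k. ys k \<in> frechet_subdiff \<phi> (xs k)) \<and> ys \<longlonglongrightarrow> y)}"

definition dom_subdiff :: "('a::euclidean_space \<Rightarrow> ereal) \<Rightarrow> 'a set" where
  "dom_subdiff \<phi> = {x \<in> effdom \<phi>. limiting_subdiff \<phi> x \<noteq> {}}"

text \<open>Unlike \<^const>\<open>infdist\<close>, this distance to the empty set is \<open>\<infinity>\<close>.\<close>

definition edist_set :: "'a::metric_space \<Rightarrow> 'a set \<Rightarrow> ereal" where
  "edist_set x S = (INF y\<in>S. ereal (dist x y))"


definition calm_on :: "'a::real_normed_vector set \<Rightarrow> ('a \<Rightarrow> ereal) \<Rightarrow> bool" where
  "calm_on A \<phi> \<longleftrightarrow> A \<subseteq> effdom \<phi> \<and>
     (\<forall>x\<in>A. \<exists>\<kappa>>0. \<exists>U. open U \<and> x \<in> U \<and>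
        (\<forall>u\<in>U \<inter> A. \<bar>\<phi> u - \<phi> x\<bar> \<le> ereal (\<kappa> * norm (u - x))))"

text \<open>The function under consideration is \<^typ>\<open>ereal\<close>-valued and may take the value \<open>\<infinity>\<close>, where
  \<^const>\<open>real_of_ereal\<close> is a junk value; hence the finiteness requirement on a neighbourhood.\<close>

definition loc_lipschitz_differentiable_on ::
  "'a::real_inner set \<Rightarrow> ('a \<Rightarrow> ereal) \<Rightarrow> bool" where
  "loc_lipschitz_differentiable_on \<Omega> h \<longleftrightarrow>
     (\<forall>x\<in>\<Omega>. \<forall>\<^sub>F z in nhds x. \<bar>h z\<bar> \<noteq> \<infinity>) \<and>
     (\<exists>G. (\<forall>x\<in>\<Omega>. GDERIV (\<lambda>z. real_of_ereal (h z)) x :> G x) \<and>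
          (\<forall>x\<in>\<Omega>. \<exists>U L. open U \<and> x \<in> U \<and>
             (\<forall>u\<in>U \<inter> \<Omega>. \<forall>v\<in>U \<inter> \<Omega>. norm (G u - G v) \<le> L * norm (u - v))))"


text \<open>A desingularizing function on \<open>[0, \<epsilon>)\<close>, where \<open>\<epsilon> = \<infinity>\<close> is allowed.\<close>

definition desingularizing :: "ereal \<Rightarrow> (real \<Rightarrow> real) \<Rightarrow> bool" where
  "desingularizing \<epsilon> p \<longleftrightarrow>
     continuous_on {s. 0 \<le> s \<and> ereal s < \<epsilon>} p \<and>
     concave_on {s. 0 \<le> s \<and> ereal s < \<epsilon>} p \<and>
     (\<forall>s. 0 \<le> s \<and> ereal s < \<epsilon> \<longrightarrow> 0 \<le> p s) \<and>
     p 0 = 0 \<and>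
     (\<forall>s. 0 < s \<and> ereal s < \<epsilon> \<longrightarrow> p differentiable (at s) \<and> 0 < deriv p s) \<and>
     continuous_on {s. 0 < s \<and> ereal s < \<epsilon>} (deriv p)"

definition KL_with ::
  "('a::euclidean_space \<Rightarrow> ereal) \<Rightarrow> 'a \<Rightarrow> ereal \<Rightarrow> real \<Rightarrow> (real \<Rightarrow> real) \<Rightarrow> bool" where
  "KL_with \<phi> x \<epsilon> \<delta> p \<longleftrightarrow>
     0 < \<epsilon> \<and> 0 < \<delta> \<and> desingularizing \<epsilon> p \<and>
     (\<forall>z. norm (z - x) < \<delta> \<and> \<phi> x < \<phi> z \<and> \<phi> z < \<phi> x + \<epsilon> \<longrightarrow>
        1 \<le> ereal (deriv p (real_of_ereal (\<phi> z - \<phi> x))) * edist_set 0 (limiting_subdiff \<phi> z))"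

definition KL_exponent :: "('a::euclidean_space \<Rightarrow> ereal) \<Rightarrow> 'a \<Rightarrow> real \<Rightarrow> bool" where
  "KL_exponent \<phi> x \<theta> \<longleftrightarrow>
     proper_fun \<phi> \<and> x \<in> dom_subdiff \<phi> \<and> 0 \<le> \<theta> \<and> \<theta> < 1 \<and>
     (\<exists>\<epsilon> \<delta> a. 0 < a \<and> KL_with \<phi> x \<epsilon> \<delta> (\<lambda>s. a * s powr (1 - \<theta>)))"


text \<open>The space of the \<open>i\<close>-th block of coordinates is identified (isometrically) with the
  coordinate subspace of vectors supported on the index set \<open>B\<close> of the block; the subvector
  \<open>x\<^sub>i\<close> of \<open>x\<close> is then \<open>block_part B x\<close>.\<close>

definition block_space :: "'n::finite set \<Rightarrow> (real ^ 'n) set" where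
  "block_space B = {x. \<forall>j. j \<notin> B \<longrightarrow> x $ j = 0}"

definition block_part :: "'n::finite set \<Rightarrow> real ^ 'n \<Rightarrow> real ^ 'n" where
  "block_part B x = (\<chi> j. if j \<in> B then x $ j else 0)"

definition block_partition :: "nat \<Rightarrow> (nat \<Rightarrow> 'n set) \<Rightarrow> bool" where
  "block_partition N B \<longleftrightarrow> (\<Union>i\<in>{1..N}. B i) = UNIV \<and> disjoint_family_on B {1..N} \<and>
     (\<forall>i\<in>{1..N}. B i \<noteq> {})"


definition nonzero_set :: "('a \<Rightarrow> ereal) \<Rightarrow> 'a set" where
  "nonzero_set g = {x. g x \<noteq> 0}"

definition zeta :: "('a \<Rightarrow> ereal) \<Rightarrow> ('a \<Rightarrow> ereal) \<Rightarrow> 'a \<Rightarrow> ereal" where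
  "zeta f h x = f x + h x"

definition eta :: "('a::real_inner \<Rightarrow> ereal) \<Rightarrow> 'a \<Rightarrow> 'a \<Rightarrow> ereal" where
  "eta g x y = ereal (x \<bullet> y) - fenchel_conj g y"

definition F_fun ::
  "('a \<Rightarrow> ereal) \<Rightarrow> ('a \<Rightarrow> ereal) \<Rightarrow> ('a \<Rightarrow> ereal) \<Rightarrow> 'a \<Rightarrow> ereal" where
  "F_fun f g h x = (if x \<in> nonzero_set g \<inter> effdom f then zeta f h x / g x else \<infinity>)"

text \<open>The norm of the product type is the Euclidean norm of the concatenated vector.\<close>

definition Q_fun ::
  "('a::real_inner \<Rightarrow> ereal) \<Rightarrow> ('a \<Rightarrow> ereal) \<Rightarrow> ('a \<Rightarrow> ereal) \<Rightarrow> 'a \<times> 'a \<Rightarrow> ereal" where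
  "Q_fun f g h = (\<lambda>(x, y).
     if (x, y) \<in> effdom f \<times> effdom (fenchel_conj g) \<and> 0 < eta g x y
     then zeta f h x / eta g x y else \<infinity>)"

end

theory Submission
  imports Defs
begin

text \<open>
  By Fenchel--Young, \<open>\<eta>(x, y) \<le> g x\<close> with equality for \<open>y \<in> \<partial>g(x)\<close>; as \<open>\<zeta> \<ge> 0\<close>, this says
  that \<open>F x \<le> Q (x, y)\<close> with equality on the graph of \<open>\<partial>g\<close>. So \<open>F\<close> is a partial minimum of
  \<open>Q\<close>, and every \<open>v \<in> \<partial>F(x)\<close> lifts to some \<open>(v, 0) \<in> \<partial>Q(x, y)\<close> with \<open>y \<in> \<partial>g(x)\<close>.
  Since \<open>\<partial>g\<close> has nonempty values, is locally bounded and has a closed graph, the KL inequalities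
  for \<open>Q\<close> at the points of \<open>{x} \<times> \<partial>g(x)\<close> give a uniform one for \<open>F\<close> at \<open>x\<close>.
\<close>

section \<open>Partial minimization\<close>

text \<open>Finiteness of \<open>\<phi> x\<close> allows clearing the denominator
  \<open>norm (z - x)\<close>. The liminf becomes a strict local affine minorant up to
  \<open>e * norm (z - x)\<close>, and extended arithmetic disappears apart from the value
  \<open>\<phi> z\<close>.\<close>

lemma frechet_subdiff_iff:
  assumes "\<phi> x = ereal c"
  shows "v \<in> frechet_subdiff \<phi> x \<longleftrightarrow>
    (\<forall>e>0. \<forall>\<^sub>F z in at x. ereal (c + v \<bullet> (z - x) - e * norm (z - x)) < \<phi> z)"
proof -
  have quot: "ereal (- e) < (\<phi> z - \<phi> x - ereal (v \<bullet> (z - x))) / ereal (norm (z - x)) \<longleftrightarrow>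
      ereal (c + v \<bullet> (z - x) - e * norm (z - x)) < \<phi> z" if "z \<noteq> x" for z e
    using that assms by (cases "\<phi> z") (auto simp: field_simps)
  have "v \<in> frechet_subdiff \<phi> x \<longleftrightarrow> (\<forall>b<0. \<forall>\<^sub>F z in at x.
      b < (\<phi> z - \<phi> x - ereal (v \<bullet> (z - x))) / ereal (norm (z - x)))"
    using assms by (simp add: frechet_subdiff_def effdom_def le_Liminf_iff)
  also have "\<dots> \<longleftrightarrow> (\<forall>e>0. \<forall>\<^sub>F z in at x.
      ereal (- e) < (\<phi> z - \<phi> x - ereal (v \<bullet> (z - x))) / ereal (norm (z - x)))" (is "?L \<longleftrightarrow> ?R")
  proof
    assume ?L
    then show ?R by auto
  next
    assume R: ?R
    show ?L
    proof (intro allI impI)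
      fix b :: ereal
      assume "b < 0"
      \<comment> \<open>\<open>b\<close> may be \<open>-\<infinity>\<close>; a real \<open>r\<close>
        strictly between \<open>b\<close> and 0 supplies the admissible error
        \<open>e = - r\<close>.\<close>
      then obtain r where r: "b < ereal r" "ereal r < 0"
        using ereal_dense2 by blast
      then have "\<forall>\<^sub>F z in at x.
          ereal (- (- r)) < (\<phi> z - \<phi> x - ereal (v \<bullet> (z - x))) / ereal (norm (z - x))"
        using R[rule_format, of "- r"] by simp
      then show "\<forall>\<^sub>F z in at x.
          b < (\<phi> z - \<phi> x - ereal (v \<bullet> (z - x))) / ereal (norm (z - x))"
        by eventually_elim (use r in auto)
    qed
  qed
  also have "\<dots> \<longleftrightarrow> (\<forall>e>0. \<forall>\<^sub>F z in at x.
      ereal (c + v \<bullet> (z - x) - e * norm (z - x)) < \<phi> z)"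
    by (intro all_cong eventually_cong[OF eventually_neq_at_within[of x x UNIV] refl])
      (use quot in \<open>auto simp: eventually_at_filter\<close>)
  finally show ?thesis .
qed

text \<open>A local minorant of \<open>\<phi>\<close> at \<open>x\<close>, extended constantly in
  the second variable, also minorizes \<open>\<psi>\<close>, which lies above \<open>\<phi>\<close>
  and touches it at \<open>(x, y)\<close>. The allowed error only grows, since
  \<open>norm (z - x)\<close> is at most the norm of the pair.\<close>

lemma frechet_subdiff_lift:
  fixes \<phi> :: "'a::euclidean_space \<Rightarrow> ereal" and \<psi> :: "'a \<times> 'b::euclidean_space \<Rightarrow> ereal"
  assumes le: "\<And>z w. \<phi> z \<le> \<psi> (z, w)"
    and eq: "\<psi> (x, y) = \<phi> x" and fin: "\<bar>\<phi> x\<bar> \<noteq> \<infinity>"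
    and v: "v \<in> frechet_subdiff \<phi> x"
  shows "(v, 0) \<in> frechet_subdiff \<psi> (x, y)"
proof -
  obtain c where c: "\<phi> x = ereal c"
    using fin by auto
  show ?thesis
    unfolding frechet_subdiff_iff[of \<psi> "(x, y)" c, OF trans[OF eq c]]
  proof (intro allI impI)
    fix e :: real
    assume e: "e > 0"
    then obtain d where d: "d > 0"
      and dz: "\<And>z. z \<noteq> x \<Longrightarrow> dist z x < d \<Longrightarrow>
        ereal (c + v \<bullet> (z - x) - e * norm (z - x)) < \<phi> z"
      using v unfolding frechet_subdiff_iff[of \<phi> x c, OF c] eventually_at by blast
    have "ereal (c + (v, 0) \<bullet> (p - (x, y)) - e * norm (p - (x, y))) < \<psi> p"
      if p: "p \<noteq> (x, y)" "dist p (x, y) < d" for p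
    proof -
      obtain z w where pz: "p = (z, w)"
        by force
      have n: "norm (z - x) \<le> norm (p - (x, y))"
        using norm_fst_le[of "z - x" "w - y"] by (simp add: pz)
      have "ereal (c + (v, 0) \<bullet> (p - (x, y)) - e * norm (p - (x, y))) < \<phi> z"
      \<comment> \<open>The minorant \<open>dz\<close> is only available off \<open>x\<close>. On
        the fibre over \<open>x\<close> the strict inequality comes from the error term, which is
        positive because \<open>p\<close> differs from \<open>(x, y)\<close>.\<close>
      proof (cases "z = x")
        case True
        then show ?thesis using p e by (simp add: pz c)
      next
        case False
        have "c + (v, 0) \<bullet> (p - (x, y)) - e * norm (p - (x, y))
            \<le> c + v \<bullet> (z - x) - e * norm (z - x)"
          using n e by (simp add: pz)
        moreover have "ereal (c + v \<bullet> (z - x) - e * norm (z - x)) < \<phi> z"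
          using dz[OF False] n p by (simp add: dist_norm)
        ultimately show ?thesis
          by (meson ereal_less_eq(3) le_less_trans)
      qed
      then show ?thesis
        using le[of z w] pz by auto
    qed
    then show "\<forall>\<^sub>F p in at (x, y).
        ereal (c + (v, 0) \<bullet> (p - (x, y)) - e * norm (p - (x, y))) < \<psi> p"
      unfolding eventually_at using d by auto
  qed
qed

text \<open>\<open>M z\<close> stands for a set of minimizers of \<open>\<psi>\<close> over the
  fibre of \<open>z\<close>. Minimizers chosen along the sequence defining \<open>v\<close> have a
  convergent subsequence, along which the values of \<open>\<psi>\<close> equal those of
  \<open>\<phi>\<close> and hence converge as required. The hypothesis \<open>compact\<close>
  combines local boundedness and closed graph of \<open>M\<close>.\<close>

lemma limiting_subdiff_lift:
  fixes \<phi> :: "'a::euclidean_space \<Rightarrow> ereal" and \<psi> :: "'a \<times> 'b::euclidean_space \<Rightarrow> ereal"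
  assumes le: "\<And>z w. \<phi> z \<le> \<psi> (z, w)"
    and eq: "\<And>z w. w \<in> M z \<Longrightarrow> z \<in> effdom \<phi> \<Longrightarrow> \<psi> (z, w) = \<phi> z"
    and proper: "proper_fun \<phi>"
    and nonempty: "\<And>z. M z \<noteq> {}"
    and compact: "\<And>zs ws z. zs \<longlonglongrightarrow> z \<Longrightarrow> (\<And>k. ws k \<in> M (zs k)) \<Longrightarrow>
      \<exists>w\<in>M z. \<exists>r. strict_mono (r::nat\<Rightarrow>nat) \<and> (ws \<circ> r) \<longlonglongrightarrow> w"
    and v: "v \<in> limiting_subdiff \<phi> x"
  shows "\<exists>y\<in>M x. (v, 0) \<in> limiting_subdiff \<psi> (x, y)"
proof -
  obtain xs vs where x: "x \<in> effdom \<phi>" and xs: "xs \<longlonglongrightarrow> x"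
    and \<phi>xs: "(\<lambda>k. \<phi> (xs k)) \<longlonglongrightarrow> \<phi> x"
    and vs: "\<And>k. vs k \<in> frechet_subdiff \<phi> (xs k)" and vv: "vs \<longlonglongrightarrow> v"
    using v by (auto simp: limiting_subdiff_def)
  \<comment> \<open>A point with a Frechet subgradient lies in the domain, so \<open>eq\<close>
    applies along the whole sequence.\<close>
  have dom: "xs k \<in> effdom \<phi>" for k
    using vs[of k] by (simp add: frechet_subdiff_def)
  have fin: "\<bar>\<phi> z\<bar> \<noteq> \<infinity>" if "z \<in> effdom \<phi>" for z
    using that proper by (auto simp: effdom_def proper_fun_on_def)
  define ws where "ws k = (SOME w. w \<in> M (xs k))" for k
  then have ws: "ws k \<in> M (xs k)" for k
    using nonempty by (simp add: some_in_eq)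
  from compact[OF xs ws] obtain y r where y: "y \<in> M x" and r: "strict_mono (r::nat\<Rightarrow>nat)"
    and lim: "(ws \<circ> r) \<longlonglongrightarrow> y"
    by blast
  have "(\<lambda>k. (xs (r k), ws (r k))) \<longlonglongrightarrow> (x, y)"
    using tendsto_Pair[OF LIMSEQ_subseq_LIMSEQ[OF xs r] lim] by (simp add: o_def)
  moreover have "(\<lambda>k. \<psi> (xs (r k), ws (r k))) \<longlonglongrightarrow> \<psi> (x, y)"
    using LIMSEQ_subseq_LIMSEQ[OF \<phi>xs r] by (simp add: o_def eq ws dom y x)
  moreover have "(vs (r k), 0) \<in> frechet_subdiff \<psi> (xs (r k), ws (r k))" for k
    using frechet_subdiff_lift[OF le eq[OF ws dom] fin[OF dom] vs] .
  moreover have "(\<lambda>k. (vs (r k), 0::'b)) \<longlonglongrightarrow> (v, 0)"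
    using tendsto_Pair[OF LIMSEQ_subseq_LIMSEQ[OF vv r] tendsto_const] by (simp add: o_def)
  moreover have "(x, y) \<in> effdom \<psi>"
    using x eq[OF y x] by (simp add: effdom_def)
  ultimately have "(v, 0) \<in> limiting_subdiff \<psi> (x, y)"
    unfolding limiting_subdiff_def
    by (intro CollectI conjI exI[of _ "\<lambda>k. (xs (r k), ws (r k))"]
        exI[of _ "\<lambda>k. (vs (r k), 0)"] allI)
  with y show ?thesis by blast
qed

section \<open>Power desingularizing functions and their rescaling\<close>

lemma deriv_cmult_powr:
  assumes "0 < s"
  shows "deriv (\<lambda>s::real. a * s powr t) s = a * (t * s powr (t - 1))"
  by (rule DERIV_imp_deriv) (use assms in \<open>auto intro!: derivative_eq_intros\<close>)

text \<open>All conditions survive positive scaling and shrinking of the interval. Thus concavity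
  and regularity of each \<open>a * s powr (1 - \<theta>)\<close> are inherited from the one
  function that the KL property of \<open>\<psi>\<close> provides.\<close>

lemma desingularizing_cmult:
  assumes p: "desingularizing \<epsilon> p" and "\<epsilon>' \<le> \<epsilon>" "0 < c"
  shows "desingularizing \<epsilon>' (\<lambda>s. c * p s)"
proof -
  have sub: "{s. 0 \<le> s \<and> ereal s < \<epsilon>'} \<subseteq> {s. 0 \<le> s \<and> ereal s < \<epsilon>}"
    "{s. 0 < s \<and> ereal s < \<epsilon>'} \<subseteq> {s. 0 < s \<and> ereal s < \<epsilon>}"
    using assms(2) by auto
  have conv: "convex {s. 0 \<le> s \<and> ereal s < \<epsilon>'}"
    unfolding is_interval_convex_1[symmetric] is_interval_1
    by (auto intro: le_less_trans[OF ereal_less_eq(3)[THEN iffD2]])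
  have diff: "p differentiable (at s)" if "0 < s" "ereal s < \<epsilon>'" for s
    using p sub(2) that by (auto simp: desingularizing_def)
  then have d: "deriv (\<lambda>s. c * p s) s = c * deriv p s" if "0 < s" "ereal s < \<epsilon>'" for s
    using that by (intro deriv_cmult)
      (simp add: field_differentiable_def real_differentiable_def)
  have "concave_on {s. 0 \<le> s \<and> ereal s < \<epsilon>'} p"
    using p sub(1) conv by (auto simp: desingularizing_def concave_on_def intro: convex_on_subset)
  then have "concave_on {s. 0 \<le> s \<and> ereal s < \<epsilon>'} (\<lambda>s. c * p s)"
    using assms(3) by (intro concave_on_cmul) auto
  moreover have "continuous_on {s. 0 \<le> s \<and> ereal s < \<epsilon>'} (\<lambda>s. c * p s)"
    using p sub(1) by (auto simp: desingularizing_def intro!: continuous_intros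
        intro: continuous_on_subset)
  moreover have "continuous_on {s. 0 < s \<and> ereal s < \<epsilon>'} (\<lambda>s. c * deriv p s)"
    using p sub(2) by (auto simp: desingularizing_def intro!: continuous_intros
        intro: continuous_on_subset)
  then have "continuous_on {s. 0 < s \<and> ereal s < \<epsilon>'} (deriv (\<lambda>s. c * p s))"
    by (rule continuous_on_eq) (use d in auto)
  ultimately show ?thesis
    using p sub diff d assms(3) unfolding desingularizing_def
    by (auto intro!: differentiable_mult zero_le_mult_iff[THEN iffD2])
qed

section \<open>The KL exponent of a partial minimum\<close>

text \<open>The KL constants of \<open>\<psi>\<close> depend on \<open>y\<close>. Uniformity is
  obtained by contradiction: points violating ever weaker inequalities for \<open>\<phi>\<close>
  lift to points converging to a single \<open>(x, y)\<close> with \<open>y \<in> M x\<close>, where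
  the KL inequality of \<open>\<psi>\<close> fails too.\<close>

theorem KL_exponent_partial_minimization:
  fixes \<phi> :: "'a::euclidean_space \<Rightarrow> ereal" and \<psi> :: "'a \<times> 'b::euclidean_space \<Rightarrow> ereal"
  assumes le: "\<And>z w. \<phi> z \<le> \<psi> (z, w)"
    and eq: "\<And>z w. w \<in> M z \<Longrightarrow> z \<in> effdom \<phi> \<Longrightarrow> \<psi> (z, w) = \<phi> z"
    and proper: "proper_fun \<phi>"
    and nonempty: "\<And>z. M z \<noteq> {}"
    and compact: "\<And>zs ws z. zs \<longlonglongrightarrow> z \<Longrightarrow> (\<And>k. ws k \<in> M (zs k)) \<Longrightarrow>
      \<exists>w\<in>M z. \<exists>r. strict_mono (r::nat\<Rightarrow>nat) \<and> (ws \<circ> r) \<longlonglongrightarrow> w"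
    and x: "x \<in> dom_subdiff \<phi>"
    and KL: "\<And>y. y \<in> M x \<Longrightarrow> KL_exponent \<psi> (x, y) \<theta>"
  shows "KL_exponent \<phi> x \<theta>"
proof -
  \<comment> \<open>\<open>b\<close> is the derivative of \<open>p 1\<close> on positive arguments,
    so the coefficient factors out of every \<open>deriv (p a)\<close>.\<close>
  define p where "p a = (\<lambda>s::real. a * s powr (1 - \<theta>))" for a
  define b where "b s = (1 - \<theta>) * s powr (- \<theta>)" for s
  obtain y0 where y0: "y0 \<in> M x"
    using nonempty by blast
  have \<theta>: "0 \<le> \<theta>" "\<theta> < 1"
    using KL[OF y0] by (auto simp: KL_exponent_def)
  have deriv_p: "deriv (p a) s = a * b s" and b_pos: "0 < b s" if "0 < s" for a s
    using that \<theta> deriv_cmult_powr[of s a "1 - \<theta>"] by (auto simp: p_def b_def)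
  have fin: "\<bar>\<phi> z\<bar> \<noteq> \<infinity>" if "z \<in> effdom \<phi>" for z
    using that proper by (auto simp: effdom_def proper_fun_on_def)
  have xdom: "x \<in> effdom \<phi>"
    using x by (simp add: dom_subdiff_def)
  then obtain c where c: "\<phi> x = ereal c"
    using fin by blast
  obtain \<epsilon>0 a0 where \<epsilon>0: "0 < \<epsilon>0" and a0: "0 < a0" and desing0: "desingularizing \<epsilon>0 (p a0)"
    using KL[OF y0] unfolding KL_exponent_def KL_with_def p_def by blast
  have desing: "desingularizing \<epsilon> (p a)" if "0 < a" "\<epsilon> \<le> \<epsilon>0" for a \<epsilon>
    using desingularizing_cmult[OF desing0 that(2), of "a / a0"] that a0 by (simp add: p_def)
  \<comment> \<open>One index shrinks the level range and the radius while enlarging the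
    coefficient, so the claim weakens as \<open>n\<close> grows. The minimum with
    \<open>\<epsilon>0\<close> keeps \<open>p (Suc n)\<close> desingularizing.\<close>
  have "\<exists>n::nat. KL_with \<phi> x (min \<epsilon>0 (1 / Suc n)) (1 / Suc n) (p (Suc n))"
  proof (rule ccontr)
    assume contra: "\<not> ?thesis"
    have "\<exists>z s v. norm (z - x) < 1 / Suc n \<and> \<phi> z = ereal (c + s) \<and> 0 < s \<and> s < 1 / Suc n \<and>
        v \<in> limiting_subdiff \<phi> z \<and> Suc n * b s * norm v < 1" for n
    proof -
      have "\<not> KL_with \<phi> x (min \<epsilon>0 (1 / Suc n)) (1 / Suc n) (p (Suc n))"
        using contra by blast
      then obtain z where z: "norm (z - x) < 1 / Suc n" "\<phi> x < \<phi> z"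
          "\<phi> z < \<phi> x + min \<epsilon>0 (1 / Suc n)"
        and ineq: "\<not> 1 \<le> ereal (deriv (p (Suc n)) (real_of_ereal (\<phi> z - \<phi> x)))
            * edist_set 0 (limiting_subdiff \<phi> z)"
        using desing[of "Suc n" "min \<epsilon>0 (1 / Suc n)"] \<epsilon>0 unfolding KL_with_def by auto
      have "\<phi> z < \<phi> x + ereal (1 / Suc n)"
        by (rule less_le_trans[OF z(3)]) (intro add_left_mono, simp)
      then obtain s where s: "\<phi> z = ereal (c + s)" "0 < s" "s < 1 / Suc n"
        using z(2) c by (cases "\<phi> z") (auto intro: that[of "real_of_ereal (\<phi> z) - c"])
      let ?D = "Suc n * b s"
      have D: "0 < ?D"
        using b_pos[OF s(2)] by simp
      \<comment> \<open>A product below 1 bounds the infimum strictly by \<open>1 / ?D\<close>, so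
        some subgradient is that short. The empty case is included, since its distance is
        \<open>\<infinity>\<close>.\<close>
      have "\<exists>v\<in>limiting_subdiff \<phi> z. ?D * norm v < 1"
      proof (rule ccontr)
        assume "\<not> ?thesis"
        then have "\<forall>v\<in>limiting_subdiff \<phi> z. 1 / ?D \<le> norm v"
          using D by (auto simp: field_simps not_less)
        then have "ereal (1 / ?D) \<le> edist_set 0 (limiting_subdiff \<phi> z)"
          unfolding edist_set_def by (intro INF_greatest) auto
        then have "ereal ?D * ereal (1 / ?D) \<le> ereal ?D * edist_set 0 (limiting_subdiff \<phi> z)"
          using D by (intro ereal_mult_left_mono) auto
        moreover have "ereal ?D * ereal (1 / ?D) = 1"
          using b_pos[OF s(2)] by simp
        ultimately have "1 \<le> ereal ?D * edist_set 0 (limiting_subdiff \<phi> z)"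
          by (simp only:)
        then show False
          using ineq s by (simp add: deriv_p c)
      qed
      then show ?thesis using z s by blast
    qed
    then obtain zs s vs where zs: "\<And>n. norm (zs n - x) < 1 / Suc n"
      and \<phi>z: "\<And>n. \<phi> (zs n) = ereal (c + s n)" and s: "\<And>n. 0 < s n" "\<And>n. s n < 1 / Suc n"
      and vs: "\<And>n. vs n \<in> limiting_subdiff \<phi> (zs n)"
      and small: "\<And>n. Suc n * b (s n) * norm (vs n) < 1"
      by metis
    have "\<exists>y\<in>M (zs n). (vs n, 0) \<in> limiting_subdiff \<psi> (zs n, y)" for n
      by (rule limiting_subdiff_lift[where \<phi> = \<phi>]) (fact le eq proper nonempty compact vs)+
    then obtain ys where ys: "\<And>n. ys n \<in> M (zs n)"
      and lift: "\<And>n. (vs n, 0) \<in> limiting_subdiff \<psi> (zs n, ys n)"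
      by metis
    have "(\<lambda>n. zs n - x) \<longlonglongrightarrow> 0"
    proof (rule Lim_null_comparison[OF _ LIMSEQ_inverse_real_of_nat])
      show "\<forall>\<^sub>F n in sequentially. norm (zs n - x) \<le> inverse (real (Suc n))"
        using zs by (intro always_eventually allI less_imp_le) (simp add: inverse_eq_divide)
    qed
    then have lim_z: "zs \<longlonglongrightarrow> x"
      by (simp add: LIM_zero_iff)
    from compact[OF this ys] obtain y r where y: "y \<in> M x"
      and r: "strict_mono (r::nat\<Rightarrow>nat)" and lim_y: "(ys \<circ> r) \<longlonglongrightarrow> y"
      by blast
    obtain \<epsilon> \<delta> a where "0 < a" and "KL_with \<psi> (x, y) \<epsilon> \<delta> (p a)"
      using KL[OF y] unfolding KL_exponent_def p_def by blast
    then have \<epsilon>: "0 < \<epsilon>" and \<delta>: "0 < \<delta>"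
      and KL_y: "\<And>q. norm (q - (x, y)) < \<delta> \<Longrightarrow> \<psi> (x, y) < \<psi> q \<Longrightarrow> \<psi> q < \<psi> (x, y) + \<epsilon> \<Longrightarrow>
        1 \<le> ereal (deriv (p a) (real_of_ereal (\<psi> q - \<psi> (x, y))))
            * edist_set 0 (limiting_subdiff \<psi> q)"
      unfolding KL_with_def by blast+
    \<comment> \<open>\<open>\<epsilon>\<close> may be \<open>\<infinity>\<close>; a real bound
      below it can be compared with the levels \<open>s n\<close>.\<close>
    obtain e where e: "0 < e" "ereal e \<le> \<epsilon>"
      using \<epsilon> by (metis ereal_dense2 ereal_less(2) less_imp_le)
    have "(\<lambda>k. (zs (r k), ys (r k))) \<longlonglongrightarrow> (x, y)"
      using tendsto_Pair[OF LIMSEQ_subseq_LIMSEQ[OF lim_z r] lim_y] by (simp add: o_def)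
    then have "\<forall>\<^sub>F k in sequentially. norm ((zs (r k), ys (r k)) - (x, y)) < \<delta>"
      using \<delta> by (simp add: tendsto_iff dist_norm)
    moreover have "\<forall>\<^sub>F k in sequentially. a \<le> real k"
      by (rule eventually_sequentiallyI[of "nat \<lceil>a\<rceil>"]) linarith
    moreover have "\<forall>\<^sub>F k in sequentially. inverse (real (Suc k)) < e"
      using LIMSEQ_inverse_real_of_nat e(1) by (rule order_tendstoD(2))
    ultimately have "\<forall>\<^sub>F k in sequentially. norm ((zs (r k), ys (r k)) - (x, y)) < \<delta> \<and>
        a \<le> real k \<and> inverse (real (Suc k)) < e"
      by (intro eventually_conj)
    then obtain k where k: "norm ((zs (r k), ys (r k)) - (x, y)) < \<delta>"
      "a \<le> real k" "inverse (real (Suc k)) < e"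
      by (auto simp: eventually_sequentially)
    let ?n = "r k"
    \<comment> \<open>Monotonicity of \<open>r\<close> carries the bounds chosen at \<open>k\<close>
      over to the index \<open>r k\<close>.\<close>
    have kn: "k \<le> ?n"
      using r by (rule seq_suble)
    have "s ?n < e"
      using s(2)[of ?n] k(3) kn le_imp_inverse_le[of "real (Suc k)" "real (Suc ?n)"]
      by (simp add: inverse_eq_divide)
    then have "ereal (s ?n) < \<epsilon>"
      using e(2) by (meson ereal_less_eq(3) less_ereal.simps(1) less_le_trans)
    moreover have \<psi>n: "\<psi> (zs ?n, ys ?n) = ereal (c + s ?n)" and \<psi>x: "\<psi> (x, y) = ereal c"
      using eq[OF ys, of ?n] eq[OF y xdom] \<phi>z c by (auto simp: effdom_def)
    ultimately have "1 \<le> ereal (a * b (s ?n)) * edist_set 0 (limiting_subdiff \<psi> (zs ?n, ys ?n))"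
      using KL_y[OF k(1)] s(1)[of ?n] deriv_p[OF s(1)[of ?n], of a]
      by (cases \<epsilon>) auto
    \<comment> \<open>The lifted subgradient \<open>(vs ?n, 0)\<close> has the same norm as
      \<open>vs ?n\<close>.\<close>
    also have "\<dots> \<le> ereal (a * b (s ?n)) * ereal (norm (vs ?n))"
    proof (rule ereal_mult_left_mono)
      show "edist_set 0 (limiting_subdiff \<psi> (zs ?n, ys ?n)) \<le> ereal (norm (vs ?n))"
        unfolding edist_set_def using lift[of ?n]
        by (rule INF_lower2) (simp add: norm_Pair)
      show "0 \<le> ereal (a * b (s ?n))"
        using \<open>0 < a\<close> b_pos[OF s(1)[of ?n]] by simp
    qed
    finally have "1 \<le> a * b (s ?n) * norm (vs ?n)"
      by simp
    \<comment> \<open>The growing coefficient has overtaken \<open>a\<close>, because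
      \<open>a \<le> k \<le> ?n\<close>; this contradicts \<open>small\<close>.\<close>
    also have "\<dots> \<le> Suc ?n * b (s ?n) * norm (vs ?n)"
      using k(2) kn b_pos[OF s(1)[of ?n]] by (intro mult_right_mono) auto
    finally show False
      using small[of ?n] by simp
  qed
  then obtain n where "KL_with \<phi> x (min \<epsilon>0 (1 / Suc n)) (1 / Suc n) (p (Suc n))"
    by blast
  then show ?thesis
    using proper x \<theta> unfolding KL_exponent_def p_def by (metis of_nat_0_less_iff zero_less_Suc)
qed


section \<open>Subgradients of finite convex functions\<close>

definition convex_subdiff :: "('a::real_inner \<Rightarrow> real) \<Rightarrow> 'a \<Rightarrow> 'a set" where
  "convex_subdiff G x = {y. \<forall>z. G x + y \<bullet> (z - x) \<le> G z}"

text \<open>A hyperplane with normal \<open>(p, q)\<close> separates \<open>(x, G x)\<close> from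
  the strict epigraph. It is not vertical because \<open>G\<close> is finite everywhere, and
  \<open>- p / q\<close> is the subgradient.\<close>

lemma convex_subdiff_nonempty:
  fixes G :: "'a::euclidean_space \<Rightarrow> real"
  assumes "convex_on UNIV G"
  shows "convex_subdiff G x \<noteq> {}"
proof -
  let ?E = "{(z, t). G z < t}"
  have "convex ?E"
  proof (rule convexI, clarsimp)
    fix z1 z2 :: 'a and t1 t2 u v :: real
    assume "G z1 < t1" "G z2 < t2" "0 \<le> u" "0 \<le> v" "u + v = 1"
    then have "G (u *\<^sub>R z1 + v *\<^sub>R z2) \<le> u * G z1 + v * G z2"
      using assms by (auto simp: convex_on_def)
    also have "\<dots> < u * t1 + v * t2"
    proof (cases "u = 0")
      case True
      then show ?thesis using \<open>G z2 < t2\<close> \<open>u + v = 1\<close> by simp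
    next
      case False
      then show ?thesis
        using \<open>G z1 < t1\<close> \<open>G z2 < t2\<close> \<open>0 \<le> u\<close> \<open>0 \<le> v\<close>
        by (intro add_less_le_mono mult_strict_left_mono mult_left_mono) auto
    qed
    finally show "G (u *\<^sub>R z1 + v *\<^sub>R z2) < u * t1 + v * t2" .
  qed
  moreover have "(x, G x + 1) \<in> ?E" "{(x, G x)} \<inter> ?E = {}"
    by auto
  ultimately have "\<exists>P c. P \<noteq> 0 \<and> (\<forall>e\<in>{(x, G x)}. P \<bullet> e \<le> c) \<and> (\<forall>e\<in>?E. c \<le> P \<bullet> e)"
    by (intro separating_hyperplane_sets) blast+
  then obtain P c where P: "P \<noteq> 0" "P \<bullet> (x, G x) \<le> c" "\<forall>e\<in>?E. c \<le> P \<bullet> e"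
    by blast
  obtain p q where Ppq: "P = (p, q)"
    by force
  have sep: "p \<bullet> x + q * G x \<le> p \<bullet> z + q * t" if "G z < t" for z t
    using P(2) P(3)[rule_format, of "(z, t)"] that by (simp add: Ppq)
  have "0 \<le> q"
    using sep[of x "G x + 1"] by (simp add: algebra_simps)
  \<comment> \<open>Passage from the strict epigraph to the graph. The height
    \<open>e / (q + 1)\<close> costs at most \<open>e\<close>, also when
    \<open>q = 0\<close>.\<close>
  have sep': "p \<bullet> x + q * G x \<le> p \<bullet> z + q * G z" for z
  proof (rule field_le_epsilon)
    fix e :: real
    assume e: "0 < e"
    have "p \<bullet> x + q * G x \<le> p \<bullet> z + q * (G z + e / (q + 1))"
      using \<open>0 \<le> q\<close> e by (intro sep) simp
    also have "\<dots> \<le> p \<bullet> z + q * G z + e"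
      using \<open>0 \<le> q\<close> e by (simp add: field_simps)
    finally show "p \<bullet> x + q * G x \<le> p \<bullet> z + q * G z + e" .
  qed
  \<comment> \<open>If \<open>q = 0\<close>, testing at \<open>x - p\<close> gives
    \<open>p = 0\<close>, against \<open>P \<noteq> 0\<close>.\<close>
  have "q \<noteq> 0"
  proof
    assume "q = 0"
    then have "p \<bullet> p \<le> 0"
      using sep'[of "x - p"] by (simp add: inner_diff_right)
    then show False
      using P(1) \<open>q = 0\<close> by (simp add: Ppq zero_prod_def inner_gt_zero_iff flip: not_less)
  qed
  with \<open>0 \<le> q\<close> have "0 < q" by simp
  then have "(p \<bullet> x - p \<bullet> z) / q \<le> G z - G x" for z
    using sep'[of z] unfolding pos_divide_le_eq[OF \<open>0 < q\<close>] by (simp add: algebra_simps)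
  then have "- (1 / q) *\<^sub>R p \<in> convex_subdiff G x"
    by (simp add: convex_subdiff_def inner_diff_right diff_divide_distrib algebra_simps)
  then show ?thesis by blast
qed

text \<open>Subgradients are bounded by the oscillation of \<open>G\<close> on a slightly larger
  ball, so a subsequence converges; continuity of \<open>G\<close> preserves the subgradient
  inequality in the limit.\<close>

lemma convex_subdiff_seq_compact:
  fixes G :: "'a::euclidean_space \<Rightarrow> real"
  assumes "convex_on UNIV G" and zs: "zs \<longlonglongrightarrow> z" and ys: "\<And>k. ys k \<in> convex_subdiff G (zs k)"
  shows "\<exists>y\<in>convex_subdiff G z. \<exists>r. strict_mono (r::nat\<Rightarrow>nat) \<and> (ys \<circ> r) \<longlonglongrightarrow> y"
proof -
  have cont: "continuous_on UNIV G"
    using assms(1) by (intro convex_on_continuous) auto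
  obtain R where R: "\<And>k. norm (zs k) \<le> R"
    using convergent_imp_Bseq[of zs] zs by (auto simp: convergent_def Bseq_def)
  have "compact (G ` cball 0 (R + 1))"
    using cont by (intro compact_continuous_image) (auto intro: continuous_on_subset)
  then have "bounded (G ` cball 0 (R + 1))"
    by (rule compact_imp_bounded)
  then obtain C where "\<forall>w\<in>cball 0 (R + 1). \<bar>G w\<bar> \<le> C"
    by (auto simp: bounded_iff)
  then have C: "\<bar>G w\<bar> \<le> C" if "norm w \<le> R + 1" for w
    using that by simp
  have "norm (ys k) \<le> 2 * C" for k
  proof -
    \<comment> \<open>A unit step along \<open>ys k\<close> turns the inner product into
      \<open>norm (ys k)\<close> and stays within radius \<open>R + 1\<close>. For
      \<open>ys k = 0\<close> the step is 0, as \<open>sgn 0 = 0\<close>.\<close>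
    have "G (zs k) + ys k \<bullet> sgn (ys k) \<le> G (zs k + sgn (ys k))"
      using ys[of k] by (simp add: convex_subdiff_def) (metis add_diff_cancel_left')
    moreover have "ys k \<bullet> sgn (ys k) = norm (ys k)"
      by (cases "ys k = 0") (simp_all add: sgn_div_norm dot_square_norm power2_eq_square)
    moreover have "norm (zs k + sgn (ys k)) \<le> R + 1"
      using norm_triangle_le[of "zs k" "sgn (ys k)" "R + 1"] R[of k] by (auto simp: norm_sgn)
    then have "\<bar>G (zs k + sgn (ys k))\<bar> \<le> C" "\<bar>G (zs k)\<bar> \<le> C"
      using C[of "zs k + sgn (ys k)"] C[of "zs k"] R[of k] by auto
    ultimately show ?thesis by linarith
  qed
  then have "ys k \<in> cball 0 (2 * C)" for k
    by simp
  then obtain y r where r: "strict_mono (r::nat\<Rightarrow>nat)" and y: "(ys \<circ> r) \<longlonglongrightarrow> y"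
    using compact_cball[of "0::'a" "2 * C"] unfolding compact_def by metis
  have zr: "(\<lambda>k. zs (r k)) \<longlonglongrightarrow> z"
    using LIMSEQ_subseq_LIMSEQ[OF zs r] by (simp add: o_def)
  have "G z + y \<bullet> (w - z) \<le> G w" for w
  proof (rule LIMSEQ_le_const2)
    have "(\<lambda>k. G (zs (r k))) \<longlonglongrightarrow> G z"
      using zr cont by (intro continuous_on_tendsto_compose[OF cont]) auto
    then show "(\<lambda>k. G (zs (r k)) + ys (r k) \<bullet> (w - zs (r k))) \<longlonglongrightarrow> G z + y \<bullet> (w - z)"
      using y zr by (intro tendsto_intros) (simp_all add: o_def)
    show "\<exists>N. \<forall>n\<ge>N. G (zs (r n)) + ys (r n) \<bullet> (w - zs (r n)) \<le> G w"
      using ys by (auto simp: convex_subdiff_def)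
  qed
  then show ?thesis
    using r y by (auto simp: convex_subdiff_def)
qed

text \<open>The global affine minorant gives a Frechet subgradient, and constant sequences make it a
  limiting one. This transfers the KL hypothesis on \<open>Q_fun\<close> to all of
  \<open>convex_subdiff\<close>.\<close>

lemma convex_subdiff_subset_limiting:
  fixes G :: "'a::euclidean_space \<Rightarrow> real"
  shows "convex_subdiff G x \<subseteq> limiting_subdiff (\<lambda>z. ereal (G z)) x"
proof
  fix y
  assume y: "y \<in> convex_subdiff G x"
  have "y \<in> frechet_subdiff (\<lambda>z. ereal (G z)) x"
    unfolding frechet_subdiff_iff[of "\<lambda>z. ereal (G z)" x "G x", OF refl]
  proof (intro allI impI)
    fix e :: real
    assume e: "0 < e"
    have "ereal (G x + y \<bullet> (z - x) - e * norm (z - x)) < ereal (G z)" if "z \<noteq> x" for z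
    proof -
      have "G x + y \<bullet> (z - x) \<le> G z" "0 < e * norm (z - x)"
        using y e that by (auto simp: convex_subdiff_def)
      then show ?thesis by simp
    qed
    then show "\<forall>\<^sub>F z in at x. ereal (G x + y \<bullet> (z - x) - e * norm (z - x)) < ereal (G z)"
      by (auto simp: eventually_at_filter)
  qed
  moreover have "x \<in> effdom (\<lambda>z. ereal (G z))"
    by (simp add: effdom_def)
  ultimately show "y \<in> limiting_subdiff (\<lambda>z. ereal (G z)) x"
    unfolding limiting_subdiff_def
    by (intro CollectI conjI exI[of _ "\<lambda>_. x"] exI[of _ "\<lambda>_. y"] allI tendsto_const)
qed

section \<open>The Fenchel-Young inequality and its equality case\<close>

lemma eta_le:
  assumes "\<bar>g x\<bar> \<noteq> \<infinity>"
  shows "eta g x y \<le> g x"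
proof -
  have "ereal (x \<bullet> y) - g x \<le> fenchel_conj g y"
    unfolding fenchel_conj_def by (rule SUP_upper) simp
  then show ?thesis
    using assms unfolding eta_def by (cases "g x"; cases "fenchel_conj g y") auto
qed

text \<open>The subgradient inequality says that the supremum is attained at \<open>x\<close>; hence
  \<open>eta\<close> equals \<open>G x\<close> there.\<close>

lemma fenchel_conj_eq:
  assumes "y \<in> convex_subdiff G x"
  shows "fenchel_conj (\<lambda>z. ereal (G z)) y = ereal (x \<bullet> y - G x)"
  unfolding fenchel_conj_def
proof (rule antisym)
  show "(SUP z. ereal (z \<bullet> y) - ereal (G z)) \<le> ereal (x \<bullet> y - G x)"
    using assms by (intro SUP_least)
      (auto simp: convex_subdiff_def inner_diff_right inner_commute algebra_simps)
  show "ereal (x \<bullet> y - G x) \<le> (SUP z. ereal (z \<bullet> y) - ereal (G z))"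
    by (rule SUP_upper2[of x]) auto
qed


section \<open>The quotient functions\<close>

text \<open>With a nonnegative numerator, replacing the positive denominator
  \<open>eta g x y\<close> by the larger \<open>g x\<close> lowers the quotient. Positivity of
  \<open>eta\<close> also forces \<open>g x \<noteq> 0\<close>.\<close>

lemma F_fun_le_Q_fun:
  assumes g: "\<bar>g x\<bar> \<noteq> \<infinity>" and \<zeta>: "x \<in> effdom f \<Longrightarrow> 0 \<le> f x + h x"
  shows "F_fun f g h x \<le> Q_fun f g h (x, y)"
proof (cases "x \<in> effdom f \<and> y \<in> effdom (fenchel_conj g) \<and> 0 < eta g x y")
  case True
  then have "0 < eta g x y" "eta g x y \<le> g x"
    using eta_le[of g x y] g by auto
  moreover from this have "x \<in> nonzero_set g"
    by (auto simp: nonzero_set_def)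
  moreover have "0 \<le> zeta f h x"
    using True \<zeta> by (simp add: zeta_def)
  ultimately show ?thesis
    using True g unfolding F_fun_def Q_fun_def
    by (cases "g x"; cases "eta g x y"; cases "zeta f h x")
      (auto simp: frac_le)
qed (auto simp: Q_fun_def)

text \<open>In the equality case the denominators agree, and \<open>eta\<close> is positive because
  \<open>G x\<close> is nonnegative and nonzero.\<close>

lemma Q_fun_eq_F_fun:
  assumes "y \<in> convex_subdiff G x" "0 \<le> G x" "x \<in> nonzero_set (\<lambda>z. ereal (G z)) \<inter> effdom f"
  shows "Q_fun f (\<lambda>z. ereal (G z)) h (x, y) = F_fun f (\<lambda>z. ereal (G z)) h x"
  using assms(2,3)
  by (auto simp: Q_fun_def F_fun_def eta_def effdom_def nonzero_set_def fenchel_conj_eq[OF assms(1)])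

lemma proper_F_fun:
  assumes g: "\<And>x. \<bar>g x\<bar> \<noteq> \<infinity>" "\<And>x. 0 \<le> g x" and \<zeta>: "\<And>x. x \<in> effdom f \<Longrightarrow> 0 \<le> f x + h x"
    and x: "x \<in> effdom (F_fun f g h)"
  shows "proper_fun (F_fun f g h)"
  unfolding proper_fun_on_def
proof safe
  fix z
  assume "F_fun f g h z = - \<infinity>"
  moreover have "0 \<le> F_fun f g h z"
  proof (cases "z \<in> nonzero_set g \<inter> effdom f")
    case True
    then have "0 \<le> zeta f h z" "0 < g z"
      using \<zeta>[of z] g(2)[of z] by (auto simp: zeta_def nonzero_set_def)
    then show ?thesis
      using True g(1)[of z] by (cases "g z"; cases "zeta f h z") (auto simp: F_fun_def)
  qed (auto simp: F_fun_def)
  ultimately show False by simp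
next
  show "\<exists>x\<in>UNIV. F_fun f g h x < \<infinity>"
    using x by (auto simp: effdom_def)
qed

theorem theorem3p3:
  fixes f g h :: "real ^ 'n \<Rightarrow> ereal"
    and N :: nat and B :: "nat \<Rightarrow> 'n set" and fi :: "nat \<Rightarrow> real ^ 'n \<Rightarrow> ereal"
    and xbar :: "real ^ 'n" and \<theta> :: real
  assumes "proper_fun f" and "lsc f"
    and "proper_fun g" and "lsc g"
    and "proper_fun h" and "lsc h"
    and "nonzero_set g \<noteq> {}"
    and "block_partition N B"
    and "\<forall>i\<in>{1..N}. proper_fun_on (block_space (B i)) (fi i) \<and> lsc_on (block_space (B i)) (fi i)"
    and "\<forall>x. f x = (\<Sum>i=1..N. fi i (block_part (B i) x))"
    and "continuous_on (effdom f) f"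
    and "\<forall>i\<in>{1..N}. \<exists>c::real. \<forall>z\<in>block_space (B i). ereal c \<le> fi i z"
    and "loc_lipschitz_differentiable_on (nonzero_set g) h"
    and "\<forall>x. \<bar>g x\<bar> \<noteq> \<infinity> \<and> 0 \<le> g x"
    and "convex_on UNIV (\<lambda>x. real_of_ereal (g x))"
    and "\<forall>x\<in>effdom f. 0 \<le> f x + h x"
    and "xbar \<in> dom_subdiff (F_fun f g h)"
    and "calm_on (effdom (fenchel_conj g)) (fenchel_conj g)"
    and "0 \<le> \<theta>" and "\<theta> < 1"
    and "\<forall>ybar\<in>limiting_subdiff g xbar. KL_exponent (Q_fun f g h) (xbar, ybar) \<theta>"
  shows "KL_exponent (F_fun f g h) xbar \<theta>"
proof -
  have gfin: "\<bar>g x\<bar> \<noteq> \<infinity>" and gpos: "0 \<le> g x" for x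
    using assms(14)[rule_format, of x] by (rule conjunct1, rule conjunct2)
  have \<zeta>: "0 \<le> f x + h x" if "x \<in> effdom f" for x
    using assms(16) that by (rule bspec)
  define G where "G = (\<lambda>x. real_of_ereal (g x))"
  have g: "g = (\<lambda>z. ereal (G z))"
  proof
    show "g z = ereal (G z)" for z
      using gfin[of z] by (cases "g z") (auto simp: G_def)
  qed
  have G: "convex_on UNIV G" "\<And>x. 0 \<le> G x"
    using gpos assms(15) by (simp_all add: G_def real_of_ereal_pos)
  show ?thesis
  proof (rule KL_exponent_partial_minimization[where M = "convex_subdiff G"])
    show "F_fun f g h z \<le> Q_fun f g h (z, w)" for z w
      using gfin \<zeta> by (rule F_fun_le_Q_fun)
    show "Q_fun f g h (z, w) = F_fun f g h z"
      if "w \<in> convex_subdiff G z" "z \<in> effdom (F_fun f g h)" for z w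
    proof -
      \<comment> \<open>Outside this set \<open>F_fun\<close> is \<open>\<infinity>\<close> by
        definition.\<close>
      have "z \<in> nonzero_set g \<inter> effdom f"
        using that(2) by (auto simp: effdom_def F_fun_def split: if_splits)
      then show ?thesis
        using that(1) G(2) unfolding g by (intro Q_fun_eq_F_fun) auto
    qed
    show "proper_fun (F_fun f g h)"
    proof (rule proper_F_fun)
      show "xbar \<in> effdom (F_fun f g h)"
        using assms(17) by (simp add: dom_subdiff_def)
    qed (fact gfin gpos \<zeta>)+
    show "convex_subdiff G z \<noteq> {}" for z
      using G(1) by (rule convex_subdiff_nonempty)
    show "\<exists>w\<in>convex_subdiff G z. \<exists>r. strict_mono (r::nat\<Rightarrow>nat) \<and> (ws \<circ> r) \<longlonglongrightarrow> w"
      if "zs \<longlonglongrightarrow> z" "\<And>k. ws k \<in> convex_subdiff G (zs k)" for zs ws z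
      using G(1) that by (rule convex_subdiff_seq_compact)
    show "xbar \<in> dom_subdiff (F_fun f g h)"
      by (rule assms(17))
    show "KL_exponent (Q_fun f g h) (xbar, y) \<theta>" if "y \<in> convex_subdiff G xbar" for y
      using assms(21) that convex_subdiff_subset_limiting[of G xbar] unfolding g by blast
  qed
qed

end
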